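(* Let $X$ be an infinite, compact, locally connected space such that $\mathsf{acl}(X)$ is a base for $X$. Then $X$ has a nontrivial convergent sequence.
   Context: All topological spaces are assumed to be Hausdorff. $\mathsf{acl}(X)$ (the almost clopen sets) denotes the family of regular open subsets $U$ of $X$ (i.e., $U=\mathrm{int}(\mathrm{cl}(U))$) whose boundary $\partial U$ is finite. A nontrivial convergent sequence is a convergent $\omega$-sequence of distinct points. *)

theory Defs
  imports "HOL-Analysis.Analysis"
begin

(* A set U with U = int (cl U) is automatically an open subset of topspace X. *)
definition regular_openin :: "'a topology \<Rightarrow> 'a set \<Rightarrow> bool" where
  "regular_openin X U \<longleftrightarrow> U = X interior_of (X closure_of U)"

definition acl :: "'a topology \<Rightarrow> 'a set set" where
  "acl X = {U. regular_openin X U \<and> finite (X frontier_of U)}"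

(* limitin only constrains the tail of a sequence, so the terms are separately
   required to be points of the space. *)
definition nontrivial_convergent_seq :: "'a topology \<Rightarrow> (nat \<Rightarrow> 'a) \<Rightarrow> bool" where
  "nontrivial_convergent_seq X s \<longleftrightarrow>
     range s \<subseteq> topspace X \<and> inj s \<and> (\<exists>l. limitin X s l sequentially)"

end

(* Shrink connected neighbourhoods U n of a non-isolated point with cl (U (n + 1)) <= U n, and walk
   inwards through connected sets Q n <= U n - U (n + 2), each containing points s n and
   s (n + 1).  No point lies in more than two of the sets Q n, so any finite frontier misses almost
   all of them; hence s is eventually on one side of every almost clopen set.  By compactness
   s has a cluster point, and s must converge to it. *)
theory Submission
  imports Defs
begin

text \<open>Inside the connected \<open>U\<close>, the component of \<open>y\<close> in the part of
  \<open>U\<close> off the closure of \<open>V\<close> cannot stop short of that closure. Adding one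
  limit point to it gives a connected set that touches the closure yet still avoids \<open>V\<close>
  itself.\<close>

lemma locally_connected_component_reaches:
  assumes X: "locally_connected_space X"
    and U: "openin X U" "connectedin X U"
    and V: "openin X V" "V \<noteq> {}" "V \<subseteq> U"
    and y: "y \<in> U" "y \<notin> X closure_of V"
  obtains Q z where "connectedin X Q" "Q \<subseteq> U - V" "y \<in> Q" "z \<in> Q" "z \<in> X closure_of V"
proof -
  \<comment> \<open>Removing the closure, not just \<open>V\<close>, keeps \<open>G\<close> open, so
    that its components are open in \<open>X\<close>.\<close>
  define G where "G = U - X closure_of V"
  define C where "C = connected_component_of_set (subtopology X G) y"
  have VG: "V \<inter> G = {}"
    unfolding G_def using closure_of_subset[OF openin_subset[OF V(1)]] by blast
  have G: "openin X G" "y \<in> G"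
    using U y by (auto simp: G_def openin_diff)
  have "openin X C"
    unfolding C_def
    using X G by (simp add: locally_connected_space_eq_open_connected_component_of)
  have "connectedin (subtopology X G) C"
    by (simp add: C_def connectedin_connected_component_of)
  then have C: "connectedin X C" "C \<subseteq> G"
    by (auto simp: connectedin_subtopology)
  have "y \<in> C"
    using G openin_subset[OF G(1)] by (simp add: C_def connected_component_of_refl subset_iff)
  \<comment> \<open>\<open>U\<close> meets \<open>C\<close> in \<open>y\<close> and leaves it
    through the nonempty \<open>V\<close>, so the connected \<open>U\<close> must cross the frontier
    of \<open>C\<close>.\<close>
  have "U \<inter> X frontier_of C \<noteq> {}"
    using connectedin_Int_frontier_of[OF U(2), of C] \<open>y \<in> C\<close> y V VG C by blast
  then obtain z where z: "z \<in> U" "z \<in> X closure_of C" "z \<notin> C"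
    using interior_of_openin[OF \<open>openin X C\<close>] by (auto simp: frontier_of_def)
  have Q: "connectedin X (insert z C)"
    using C(1) z(2) closure_of_subset[OF connectedin_subset_topspace[OF C(1)]]
    by (intro connectedin_intermediate_closure_of[OF C(1)]) auto
  \<comment> \<open>Otherwise \<open>z\<close> lies in \<open>G\<close>, and
    \<open>insert z C\<close> is a larger connected subset of \<open>G\<close>, against the
    maximality of \<open>C\<close>.\<close>
  have "z \<in> X closure_of V"
  proof (rule ccontr)
    assume "z \<notin> X closure_of V"
    then have "connectedin (subtopology X G) (insert z C)"
      using Q C z(1) by (auto simp: connectedin_subtopology G_def)
    then have "insert z C \<subseteq> C"
      using connected_component_of_maximal[of _ "insert z C" y] \<open>y \<in> C\<close> unfolding C_def by blast
    with z(3) show False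
      by blast
  qed
  \<comment> \<open>The open set \<open>V\<close> misses \<open>C\<close>, so it contains no point
    of the closure of \<open>C\<close>.\<close>
  moreover have "z \<notin> V"
    using z(2) V(1) VG C(2) unfolding in_closure_of by blast
  ultimately show thesis
    using that[OF Q] \<open>y \<in> C\<close> z(1) C(2) VG unfolding G_def by blast
qed

text \<open>A connected \<open>Q n\<close> meeting both a set and its complement meets the frontier
  of that set. So \<open>s\<close> can change sides only at the finitely many \<open>n\<close> whose
  link contains one of the finitely many frontier points.\<close>

lemma limitin_if_connected_links:
  fixes s :: "nat \<Rightarrow> 'a"
  assumes X: "compact_space X" and T1: "t1_space X"
    and base: "\<And>W x. openin X W \<Longrightarrow> x \<in> W \<Longrightarrow>
      \<exists>U. openin X U \<and> finite (X frontier_of U) \<and> x \<in> U \<and> U \<subseteq> W"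
    and "inj s"
    and Q: "\<And>n. connectedin X (Q n)" "\<And>n. s n \<in> Q n" "\<And>n. s (Suc n) \<in> Q n"
    and fin: "\<And>x. finite {n. x \<in> Q n}"
  obtains l where "limitin X s l sequentially"
proof -
  have "range s \<subseteq> topspace X"
    using Q(2) connectedin_subset_topspace[OF Q(1)] by blast
  moreover have "infinite (range s)"
    using \<open>inj s\<close> by (rule range_inj_infinite)
  ultimately obtain l where l: "l \<in> X derived_set_of (range s)"
    using compact_space_imp_Bolzano_Weierstrass[OF X] by blast
  have "\<forall>\<^sub>F n in sequentially. s n \<in> W" if W: "openin X W" "l \<in> W" for W
  proof -
    obtain U where U: "openin X U" "finite (X frontier_of U)" "l \<in> U" "U \<subseteq> W"
      using base[OF W] by blast
    have "finite (\<Union>x \<in> X frontier_of U. {n. x \<in> Q n})"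
      using U(2) fin by blast
    then obtain N where "\<forall>n \<in> (\<Union>x \<in> X frontier_of U. {n. x \<in> Q n}). n < N"
      using finite_nat_set_iff_bounded by blast
    then have "Q n \<inter> X frontier_of U = {}" if "n \<ge> N" for n
      using that leD[of N n] by blast
    then have "Q n \<subseteq> U \<or> Q n \<inter> U = {}" if "n \<ge> N" for n
      using that connectedin_Int_frontier_of[OF Q(1), of n U] by blast
    then have step: "s (Suc n) \<in> U \<longleftrightarrow> s n \<in> U" if "n \<ge> N" for n
      using that Q(2,3)[of n] by blast
    have const: "s n \<in> U \<longleftrightarrow> s N \<in> U" if "n \<ge> N" for n
      using that by (induction rule: dec_induct) (simp_all add: step)
    \<comment> \<open>Deleting the terms before index \<open>N\<close> forces the accumulation point
      to supply a term in \<open>U\<close> of index at least \<open>N\<close>. The point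
      \<open>l\<close> is kept because it may itself be an early term.\<close>
    define F where "F = s ` {..<N} - {l}"
    have "finite F" "F \<subseteq> topspace X"
      using \<open>range s \<subseteq> topspace X\<close> by (auto simp: F_def)
    then have "closedin X F"
      using T1 by (simp add: t1_space_closedin_finite)
    then have "openin X (U - F)" "l \<in> U - F"
      using U(1,3) openin_diff by (blast, simp add: F_def)
    then obtain m where "s m \<noteq> l" "s m \<in> U - F"
      using l unfolding in_derived_set_of by blast
    then have "m \<notin> {..<N}" "s m \<in> U"
      unfolding F_def by blast+
    then have "s N \<in> U"
      using const[of m] by (simp add: not_less)
    then show ?thesis
      using const U(4) unfolding eventually_sequentially by blast
  qed
  then show thesis
    using l that[of l] unfolding limitin_def in_derived_set_of by blast
qed

lemma nested_connected_neighbourhoods: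
  assumes X: "regular_space X" "t1_space X" "locally_connected_space X"
    and p: "p \<in> X derived_set_of topspace X"
  obtains U :: "nat \<Rightarrow> 'a set" where
    "\<And>n. openin X (U n)" "\<And>n. connectedin X (U n)" "\<And>n. p \<in> U n"
    "\<And>n. X closure_of U (Suc n) \<subseteq> U n" "\<And>n. U (Suc n) \<noteq> U n"
proof -
  define P where "P U \<longleftrightarrow> openin X U \<and> connectedin X U \<and> p \<in> U" for U
  have p': "p \<in> topspace X" "\<And>T. p \<in> T \<Longrightarrow> openin X T \<Longrightarrow> \<exists>y\<in>T. y \<noteq> p"
    using p by (auto simp: in_derived_set_of)
  have *: "\<exists>U. P U \<and> U \<subseteq> W" if "openin X W" "p \<in> W" for W
    using X(3) that unfolding locally_connected_space P_def by blast
  have step: "\<exists>U. P U \<and> X closure_of U \<subseteq> W \<and> U \<noteq> W" if "P W" for W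
  proof -
    have W: "openin X W" "p \<in> W"
      using that by (auto simp: P_def)
    obtain q where q: "q \<in> W" "q \<noteq> p"
      using p'(2) W by blast
    \<comment> \<open>Discarding \<open>q\<close> before shrinking makes the new neighbourhood
      differ from \<open>W\<close>; regularity then provides a closed \<open>B\<close> that bounds
      its closure.\<close>
    have "openin X (W - {q})"
      using X(2) W by (simp add: openin_diff closedin_t1_singleton q openin_subset[THEN subsetD])
    then obtain A B where "openin X A" "closedin X B" "p \<in> A" "A \<subseteq> B" "B \<subseteq> W - {q}"
      using X(1) q W unfolding neighbourhood_base_of_closedin[symmetric] neighbourhood_base_of
      by (metis DiffI singletonD)
    moreover then obtain U where "P U" "U \<subseteq> A"
      using * by blast
    ultimately show ?thesis
      using q(1) closure_of_minimal[of U B X] by blast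
  qed
  have "\<exists>U::nat \<Rightarrow> 'a set. \<forall>n. P (U n) \<and> X closure_of U (Suc n) \<subseteq> U n \<and> U (Suc n) \<noteq> U n"
    using *[OF openin_topspace p'(1)] step
    by (intro dependent_nat_choice[where P = "\<lambda>_. P"
          and Q = "\<lambda>_ W U. X closure_of U \<subseteq> W \<and> U \<noteq> W"]) auto
  then show thesis
    using that unfolding P_def by blast
qed

theorem theorem4p12:
  fixes X :: "'a topology"
  assumes "Hausdorff_space X"
    and "infinite (topspace X)"
    and "compact_space X"
    and "locally_connected_space X"
    and "openin X = arbitrary union_of (\<lambda>U. U \<in> acl X)"
  shows "\<exists>s. nontrivial_convergent_seq X s"
proof -
  obtain p where "p \<in> X derived_set_of topspace X"
    using compact_space_imp_Bolzano_Weierstrass[OF assms(3,2)] by blast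
  then obtain U :: "nat \<Rightarrow> 'a set" where U: "\<And>n. openin X (U n)" "\<And>n. connectedin X (U n)"
      "\<And>n. p \<in> U n" "\<And>n. X closure_of U (Suc n) \<subseteq> U n" "\<And>n. U (Suc n) \<noteq> U n"
    using nested_connected_neighbourhoods[OF compact_Hausdorff_imp_regular_space[OF assms(3,1)]
        Hausdorff_imp_t1_space[OF assms(1)] assms(4)] by blast
  have sub: "U (Suc n) \<subseteq> U n" for n
    using U(4)[of n] closure_of_subset[OF openin_subset[OF U(1)]] by blast
  have mono: "U n \<subseteq> U m" if "m \<le> n" for m n
    using lift_Suc_antimono_le[of U, OF sub that] .
  define link where "link n y z Q \<longleftrightarrow>
    connectedin X Q \<and> Q \<subseteq> U n - U (Suc (Suc n)) \<and> y \<in> Q \<and> z \<in> Q" for n y z Q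
  \<comment> \<open>The sequence visits the layers \<open>U n - U (Suc n)\<close> one by one. The
    end \<open>z\<close> of the link avoids \<open>U (Suc (Suc n))\<close> but lies in its closure,
    hence in \<open>U (Suc n)\<close>: exactly the next layer.\<close>
  have step: "\<exists>z. z \<in> U (Suc n) - U (Suc (Suc n)) \<and> (\<exists>Q. link n y z Q)"
    if y: "y \<in> U n - U (Suc n)" for n y
  proof -
    have "y \<notin> X closure_of U (Suc (Suc n))"
      using y U(4) by blast
    then obtain Q z where "connectedin X Q" "Q \<subseteq> U n - U (Suc (Suc n))" "y \<in> Q" "z \<in> Q"
        "z \<in> X closure_of U (Suc (Suc n))"
      using y locally_connected_component_reaches[OF assms(4) U(1,2) U(1), of "Suc (Suc n)" n y]
        U(3) mono[of n "Suc (Suc n)"] by force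
    then show ?thesis
      using U(4)[of "Suc n"] unfolding link_def by blast
  qed
  have "\<exists>y. y \<in> U 0 - U (Suc 0)"
    using sub[of 0] U(5)[of 0] by blast
  then have "\<exists>s. \<forall>n. s n \<in> U n - U (Suc n) \<and> (\<exists>Q. link n (s n) (s (Suc n)) Q)"
    using step by (intro dependent_nat_choice[where P = "\<lambda>n y. y \<in> U n - U (Suc n)"
          and Q = "\<lambda>n y z. \<exists>Q. link n y z Q"])
  then obtain s Q where s: "\<And>n. s n \<in> U n - U (Suc n)"
      and Q: "\<And>n. link n (s n) (s (Suc n)) (Q n)"
    by metis
  \<comment> \<open>Distinct layers are disjoint.\<close>
  have "s m \<noteq> s n" if "m < n" for m n
    using s[of m] s[of n] mono[of "Suc m" n] that by auto
  then have "inj s"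
    by (auto intro!: linorder_injI)
  \<comment> \<open>A link \<open>Q m\<close> through \<open>x\<close> puts \<open>x\<close> outside
    \<open>U (Suc (Suc m))\<close>, while any link \<open>Q n\<close> through \<open>x\<close> puts
    it in \<open>U n\<close>; hence \<open>n < m + 2\<close>.\<close>
  have "finite {n. x \<in> Q n}" for x
  proof (cases "\<exists>m. x \<in> Q m")
    case True
    then obtain m where "x \<notin> U (Suc (Suc m))"
      using Q unfolding link_def by blast
    moreover have "x \<in> U n" if "x \<in> Q n" for n
      using Q that unfolding link_def by blast
    ultimately have "{n. x \<in> Q n} \<subseteq> {..<Suc (Suc m)}"
      using mono by (blast intro: leI)
    then show ?thesis
      using finite_subset by blast
  qed simp
  moreover have "\<exists>V. openin X V \<and> finite (X frontier_of V) \<and> x \<in> V \<and> V \<subseteq> W"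
    if "openin X W" "x \<in> W" for W x
    using assms(5) that unfolding openin_topology_base_unique acl_def by blast
  ultimately obtain l where "limitin X s l sequentially"
    using limitin_if_connected_links[OF assms(3) Hausdorff_imp_t1_space[OF assms(1)] _ \<open>inj s\<close>, of Q] Q unfolding link_def by blast
  moreover have "range s \<subseteq> topspace X"
    using s openin_subset[OF U(1)] by blast
  ultimately show ?thesis
    using \<open>inj s\<close> unfolding nontrivial_convergent_seq_def by blast
qed

end
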